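(* Let $P$ be a stochastic matrix over the finite set $X = X^o \cup \partial X$ satisfying properties (i), (ii), (iii) listed in the context. Let $\lambda\in\mathrm{spec}(P_{X^o})$, let $n\ge 1$ be an integer, and let $f_j^{(k)}$ ($k=1,\dots,\kappa_j$, $j=1,\dots,\mu$) be the Jordan chain functions of $P_{X^o}$ for the eigenvalue $\lambda$, extended by $0$ to $\partial X$, as defined in the context. Then the space of functions $f:X\to\mathbb{C}$ with $(\lambda\cdot I-P)^n f=0$ on $X$ is spanned by $$\bigl\{ f_j^{(k)} : k=1,\dots,\min\{n,\kappa_j\},\; j=1,\dots,\mu\bigr\}.$$
   Context: $X$ is a finite set, the disjoint union of two non-empty subsets $X^o$ (the interior) and $\partial X$ (the boundary). $P = (p(x,y))_{x,y\in X}$ is a stochastic matrix (non-negative entries, row sums $1$), and $p^{(n)}(x,y)$ denotes the $(x,y)$-entry of $P^n$. The standing assumptions are: (i) for every $x\in X^o$ there is $w\in\partial X$ with $p^{(n)}(x,w)>0$ for some $n$; (ii) for every $w\in\partial X$, $p(w,w)=1$, and thus $p(w,x)=0$ for all $x\in X\setminus\{w\}$; (iii) for every $w\in\partial X$ there is $x\in X^o$ with $p^{(n)}(x,w)>0$ for some $n$. $P$ acts on functions (column vectors) $f:X\to\mathbb{C}$ by $Pf(x)=\sum_{y\in X} p(x,y)f(y)$; $I$ is the identity matrix over $X$ and $I_{X^o}$ the identity matrix over $X^o$. $P_{X^o}=(p(x,y))_{x,y\in X^o}$, and $\mathrm{spec}(P_{X^o})\subset\mathbb{C}$ is the set of its eigenvalues.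 Jordan chain functions: for $\lambda\in\mathrm{spec}(P_{X^o})$ let $\kappa$ and $\mu$ be the algebraic and the geometric multiplicity of $\lambda$ as an eigenvalue of $P_{X^o}$. Let $h_1,\dots,h_\mu$ be a basis of $\ker(\lambda\cdot I_{X^o}-P_{X^o})$, and for each $j\in\{1,\dots,\mu\}$ let $\kappa_j$ be the length of the associated Jordan chain (the dimension of the associated Jordan block in the Jordan normal form). That is, $\kappa_1+\dots+\kappa_\mu=\kappa$, and there are functions $f_j^{(k)}:X^o\to\mathbb{C}$, $k=1,\dots,\kappa_j$, such that $f_j^{(1)}=h_j$ and $(\lambda\cdot I_{X^o}-P_{X^o})f_j^{(k)}=f_j^{(k-1)}$ for $k\ge 2$. (The basis $h_1,\dots,h_\mu$ is thus the one coming from a Jordan basis.) All functions $f_j^{(k)}$ are extended to $X$ by assigning the value $0$ on $\partial X$. *)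

theory Defs
  imports
    "HOL-Analysis.Analysis"
    "HOL-Computational_Algebra.Polynomial"
begin

text \<open>
  The finite set $X$, a disjoint union of two non-empty parts, is the sum type \<open>'i + 'b\<close> of two
  finite types: \<open>Inl\<close> embeds the interior $X^o$ and \<open>Inr\<close> the boundary. Functions from a finite
  type \<open>'n\<close> to the complex numbers are elements of \<^typ>\<open>complex ^ 'n\<close>, and spans, independence and
  dimensions are those over the complex field (\<open>vec.span\<close> etc., not the real-linear \<open>span\<close>).
\<close>

definition stochastic :: "real ^ 'n ^ 'n \<Rightarrow> bool" where
  "stochastic P \<longleftrightarrow> (\<forall>x y. 0 \<le> P $ x $ y) \<and> (\<forall>x. (\<Sum>y\<in>UNIV. P $ x $ y) = 1)"

primrec mpow :: "'a::semiring_1 ^ 'n ^ 'n \<Rightarrow> nat \<Rightarrow> 'a ^ 'n ^ 'n" where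
  "mpow A 0 = mat 1"
| "mpow A (Suc n) = A ** mpow A n"

definition complex_mat :: "real ^ 'n ^ 'n \<Rightarrow> complex ^ 'n ^ 'n" where
  "complex_mat P = map_matrix complex_of_real P"

definition interior_block :: "'a ^ ('i::finite + 'b::finite) ^ ('i + 'b) \<Rightarrow> 'a ^ 'i ^ 'i" where
  "interior_block A = (\<chi> x y. A $ Inl x $ Inl y)"

definition extend_zero :: "'a::zero ^ 'i \<Rightarrow> 'a ^ ('i::finite + 'b::finite)" where
  "extend_zero f = (\<chi> z. case z of Inl x \<Rightarrow> f $ x | Inr w \<Rightarrow> 0)"

text \<open>\<open>mat l\<close> is the matrix with \<open>l\<close> on the diagonal and \<open>0\<close> elsewhere, i.e. $l \cdot I$.\<close>

definition scalar_minus :: "'a::ring_1 \<Rightarrow> 'a ^ 'n ^ 'n \<Rightarrow> 'a ^ 'n ^ 'n" where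
  "scalar_minus l A = mat l - A"

definition spec :: "complex ^ 'n ^ 'n \<Rightarrow> complex set" where
  "spec A = {l. \<exists>v. v \<noteq> 0 \<and> A *v v = l *s v}"

definition charpoly :: "complex ^ 'n ^ 'n \<Rightarrow> complex poly" where
  "charpoly A = det (scalar_minus [:0, 1:] (map_matrix (\<lambda>a. [:a:]) A))"

definition alg_mult :: "complex ^ 'n ^ 'n \<Rightarrow> complex \<Rightarrow> nat" where
  "alg_mult A l = Polynomial.order l (charpoly A)"

definition geo_mult :: "complex ^ 'n ^ 'n \<Rightarrow> complex \<Rightarrow> nat" where
  "geo_mult A l = vec.dim {v. scalar_minus l A *v v = 0}"

text \<open>
  \<open>jordan_chains A l \<kappa> f\<close>: the functions \<open>f j k\<close>, for \<open>j = 1..geo_mult A l\<close> and \<open>k = 1..\<kappa> j\<close>, are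
  Jordan chains of \<open>A\<close> for the eigenvalue \<open>l\<close>. The values of \<open>\<kappa>\<close> and \<open>f\<close> at other indices are
  irrelevant. The chain lengths sum to the algebraic multiplicity, so no chain can be
  prolonged and \<open>\<kappa> j\<close> is the size of the corresponding Jordan block.
\<close>

definition jordan_chains ::
  "complex ^ 'n ^ 'n \<Rightarrow> complex \<Rightarrow> (nat \<Rightarrow> nat) \<Rightarrow> (nat \<Rightarrow> nat \<Rightarrow> complex ^ 'n) \<Rightarrow> bool" where
  "jordan_chains A l \<kappa> f \<longleftrightarrow>
     inj_on (\<lambda>j. f j 1) {1..geo_mult A l} \<and>
     vec.independent ((\<lambda>j. f j 1) ` {1..geo_mult A l}) \<and>
     vec.span ((\<lambda>j. f j 1) ` {1..geo_mult A l}) = {v. scalar_minus l A *v v = 0} \<and>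
     (\<forall>j\<in>{1..geo_mult A l}. 1 \<le> \<kappa> j) \<and>
     (\<Sum>j = 1..geo_mult A l. \<kappa> j) = alg_mult A l \<and>
     (\<forall>j\<in>{1..geo_mult A l}. \<forall>k\<in>{2..\<kappa> j}. scalar_minus l A *v f j k = f j (k - 1))"

end

theory Submission
  imports Defs
begin

text \<open>
  On a boundary point $(\lambda I - P)^n$ acts as multiplication by $(\lambda - 1)^n$, and
  $\lambda \neq 1$: an eigenfunction of $P_{X^o}$ for the eigenvalue $1$, extended by zero, would
  be $P^m$-harmonic for every $m$, against the maximum principle at a point from which the
  boundary is reached. So the kernel of $(\lambda I - P)^n$ is the zero extension of the kernel
  of $N^n$, where $N = \lambda I_{X^o} - P_{X^o}$.

  Applying $N^{K-1}$ to a linear combination of chain functions, where $K$ is the highest level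
  that occurs, leaves a combination of the independent $h_j$. Hence the chain functions are
  independent, and a combination killed by $N^n$ only involves levels $k \le n$. There are as
  many chain functions as the algebraic multiplicity of $\lambda$, which bounds the dimension
  of the kernel of every power of $N$, so they span these kernels for large powers.
\<close>

section \<open>Matrix powers and the characteristic polynomial\<close>

lemma mpow_mult_vector: "mpow A n *v v = (((*v) A) ^^ n) v"
  by (induction n) (simp_all flip: matrix_vector_mul_assoc)

lemma funpow_mult_zero [simp]:
  fixes A :: "'a::field ^ 'n ^ 'n"
  shows "(((*v) A) ^^ n) 0 = 0"
  by (induction n) auto

lemma linear_funpow_mult:
  fixes A :: "'a::field ^ 'n ^ 'n"
  shows "Vector_Spaces.linear (*s) (*s) (((*v) A) ^^ n)"
proof -
  have "((*v) A) ^^ n = (*v) (mpow A n)"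
    by (rule ext) (simp add: mpow_mult_vector)
  then show ?thesis
    by simp
qed

lemma scalar_minus_mult_vector:
  "scalar_minus l A *v v = l *s v - A *v v" for A :: "'a::comm_ring_1 ^ 'n ^ 'n"
  by (simp add: scalar_minus_def matrix_vector_mult_diff_rdistrib)
    (simp add: vec_eq_iff matrix_vector_mult_def mat_def if_distrib[of "\<lambda>x. x * _"] cong: if_cong)

text \<open>Evaluation at \<open>z\<close> is a ring homomorphism, so it commutes with the Leibniz
  sum.\<close>

lemma poly_det: "poly (det M) z = det (map_matrix (\<lambda>p. poly p z) M)"
  by (simp add: det_def poly_sum poly_prod)

lemma poly_charpoly: "poly (charpoly A) z = det (scalar_minus z A)"
proof -
  have "map_matrix (\<lambda>p. poly p z) (scalar_minus [:0, 1:] (map_matrix (\<lambda>a. [:a:]) A)) = scalar_minus z A"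
    by (simp add: vec_eq_iff scalar_minus_def mat_def)
  then show ?thesis
    by (simp add: charpoly_def poly_det)
qed

text \<open>A number beyond an operator norm bound of \<open>A\<close> is no eigenvalue, so the
  polynomial does not vanish there. Nonvanishing is what turns divisibility by a power of a linear
  factor into a lower bound for \<open>alg_mult\<close>.\<close>

lemma charpoly_nonzero: "charpoly A \<noteq> 0"
proof
  assume 0: "charpoly A = 0"
  obtain K where K: "\<And>v. norm (A *v v) \<le> norm v * K" "K > 0"
    using bounded_linear.pos_bounded[OF matrix_vector_mul_bounded_linear[of A]] by metis
  define z where "z = complex_of_real (K + 1)"
  have "det (scalar_minus z A) = 0"
    using 0 poly_charpoly[of A z] by simp
  then have "\<not> invertible (scalar_minus z A)"
    by (simp add: invertible_det_nz)
  then obtain v where v: "v \<noteq> 0" "scalar_minus z A *v v = 0"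
    using matrix_left_invertible_ker[of "scalar_minus z A"] invertible_left_inverse by metis
  then have "A *v v = z *s v"
    by (simp add: scalar_minus_mult_vector)
  moreover have "norm (z *s v) = (K + 1) * norm v"
  proof -
    have "z *s v = (K + 1) *\<^sub>R v"
      unfolding z_def vec_eq_iff vector_smult_component vector_scaleR_component by (metis scaleR_conv_of_real)
    then show ?thesis using K by simp
  qed
  ultimately show False
    using K(1)[of v] v(1) by (simp add: algebra_simps)
qed

section \<open>Algebraic multiplicity as a bound for kernels of powers\<close>

text \<open>Every permutation with a nonzero Leibniz term fixes \<open>D\<close> pointwise, so each
  term contains the factor \<open>c ^ card D\<close>. The rank \<open>r\<close> expresses
  triangularity without an order on the index type.\<close>

lemma power_dvd_det_if_triangular_on:
  fixes M :: "'a::comm_ring_1 ^ 'n ^ 'n" and r :: "'n \<Rightarrow> nat"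
  assumes diag: "\<And>i. i \<in> D \<Longrightarrow> M $ i $ i = c"
    and off: "\<And>i j. i \<in> D \<Longrightarrow> j \<noteq> i \<Longrightarrow> M $ j $ i \<noteq> 0 \<Longrightarrow> j \<in> D \<and> r j < r i"
  shows "c ^ card D dvd det M"
proof -
  have "c ^ card D dvd (\<Prod>i\<in>UNIV. M $ p i $ i)" if p: "p permutes UNIV" for p
  proof (cases "\<forall>i. M $ p i $ i \<noteq> 0")
    case False
    then have "(\<Prod>i\<in>UNIV. M $ p i $ i) = 0"
      by (intro prod_zero) auto
    then show ?thesis
      by (metis dvd_0_right)
  next
    case nz: True
    \<comment> \<open>Induction on the rank: if \<open>p\<close> moved \<open>i\<close>, it would move it to a fixed point of lower rank.\<close>
    have fixed: "p i = i" if "i \<in> D" for i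
      using that
    proof (induction "r i" arbitrary: i rule: less_induct)
      case less
      show ?case
      proof (rule ccontr)
        assume ne: "p i \<noteq> i"
        then have "p i \<in> D" "r (p i) < r i"
          using off[OF less.prems ne] nz by auto
        then have "p (p i) = p i"
          using less.hyps by blast
        then show False
          using ne permutes_inj[OF p] by (simp add: inj_eq)
      qed
    qed
    have "(\<Prod>i\<in>UNIV. M $ p i $ i) = (\<Prod>i\<in>D. M $ p i $ i) * (\<Prod>i\<in>-D. M $ p i $ i)"
      by (subst prod.union_disjoint[symmetric]) (auto intro: finite_subset[of _ UNIV])
    also have "(\<Prod>i\<in>D. M $ p i $ i) = c ^ card D"
      by (simp add: fixed diag)
    finally show ?thesis
      by simp
  qed
  \<comment> \<open>The Leibniz formula runs over the entries \<open>M $ i $ p i\<close>; the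
    transpose turns them into the entries \<open>M $ p i $ i\<close> considered above.\<close>
  then have "c ^ card D dvd det (transpose M)"
    unfolding det_def by (auto simp: transpose_def intro!: dvd_sum dvd_mult)
  then show ?thesis
    by simp
qed

text \<open>The basis grows along the increasing chain of kernels, and the rank records the stage at
  which a vector enters. This gives the triangular form of N without any Jordan normal form. The
  bound on the rank keeps old vectors strictly below the new ones in the induction.\<close>

lemma ranked_basis_kernel_power:
  fixes N :: "'a::field ^ 'n ^ 'n"
  shows "\<exists>B r. vec.independent B \<and> vec.span B = {v. (((*v) N) ^^ k) v = 0} \<and>
    (\<forall>b\<in>B. r b \<le> k \<and> N *v b \<in> vec.span {b' \<in> B. r b' < r b})"
proof (induction k)
  case 0
  show ?case
    by (rule exI[of _ "{}"]) (simp add: vec.independent_empty)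
next
  case (Suc k)
  then obtain B r where B: "vec.independent B" "vec.span B = {v. (((*v) N) ^^ k) v = 0}"
    "\<And>b. b \<in> B \<Longrightarrow> r b \<le> k" "\<And>b. b \<in> B \<Longrightarrow> N *v b \<in> vec.span {b' \<in> B. r b' < r b}"
    by blast
  let ?V = "{v. (((*v) N) ^^ Suc k) v = 0}"
  have "B \<subseteq> ?V"
    using vec.span_superset[of B] B(2) by auto
  then obtain B' where B': "B \<subseteq> B'" "B' \<subseteq> ?V" "vec.independent B'" "?V \<subseteq> vec.span B'"
    using B(1) vec.maximal_independent_subset_extend by metis
  have "vec.subspace ?V"
    using vec.linear_subspace_kernel[OF linear_funpow_mult[where A = N and n = "Suc k"]] .
  then have span: "vec.span B' = ?V"
    using B' by (simp add: subset_antisym vec.span_minimal)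
  define r' where "r' b = (if b \<in> B then r b else Suc k)" for b
  have "r' b \<le> Suc k" if "b \<in> B'" for b
    using B(3) by (simp add: r'_def le_SucI)
  moreover have "N *v b \<in> vec.span {c \<in> B'. r' c < r' b}" if b: "b \<in> B'" for b
  proof (cases "b \<in> B")
    case True
    have "{c \<in> B. r c < r b} \<subseteq> {c \<in> B'. r' c < r' b}"
      using True B'(1) by (auto simp: r'_def)
    then show ?thesis
      using B(4)[OF True] vec.span_mono by blast
  next
    case False
    \<comment> \<open>N maps the kernel of its power k + 1 into the kernel of its power k, which is
      the span of \<open>B\<close>.\<close>
    have "N *v b \<in> vec.span B"
      using b B'(2) unfolding B(2) by (auto simp: funpow_Suc_right simp del: funpow.simps)
    moreover have "B \<subseteq> {c \<in> B'. r' c < r' b}"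
      using False B'(1) B(3) by (auto simp: r'_def le_imp_less_Suc)
    ultimately show ?thesis
      using vec.span_mono by blast
  qed
  ultimately show ?case
    using B'(3) span by blast
qed

text \<open>A ranked basis \<open>B\<close> of the kernel is extended to a basis \<open>C\<close> of
  the whole space. In this basis the columns belonging to \<open>B\<close> contribute
  \<open>card B\<close> linear factors with root \<open>l\<close> to the characteristic
  polynomial.\<close>

lemma dim_kernel_power_le_alg_mult:
  fixes A :: "complex ^ 'n ^ 'n"
  shows "vec.dim {v. (((*v) (scalar_minus l A)) ^^ k) v = 0} \<le> alg_mult A l"
proof -
  let ?N = "scalar_minus l A" and ?const = "map_matrix (\<lambda>a. [:a:]) :: complex ^ 'n ^ 'n \<Rightarrow> _"
  obtain B r where B: "vec.independent B" "vec.span B = {v. (((*v) ?N) ^^ k) v = 0}"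
    "\<And>b. b \<in> B \<Longrightarrow> ?N *v b \<in> vec.span {b' \<in> B. r b' < (r b :: nat)}"
    using ranked_basis_kernel_power[where N = ?N and k = k] by blast
  obtain C where C: "B \<subseteq> C" "vec.independent C" "vec.span C = UNIV"
    using B(1) vec.extend_basis_superset vec.independent_extend_basis vec.span_extend_basis by blast
  have finC: "finite C"
    using C(2) by (rule vec.finiteI_independent)
  have "card C = CARD('n)"
    using vec.dim_eq_card[of C UNIV] C by (simp add: card_cart_basis)
  \<comment> \<open>Enumerating \<open>C\<close> by the index type itself makes the base change a
    square matrix of the same type as \<open>A\<close>.\<close>
  then obtain \<sigma> where \<sigma>: "bij_betw \<sigma> (UNIV :: 'n set) C"
    using finite_same_card_bij[OF finite_class.finite_UNIV finC] by auto
  then have \<sigma>C: "\<sigma> i \<in> C" for i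
    by (auto simp: bij_betw_def)
  define S where "S = (\<chi> i j. \<sigma> j $ i)"
  define T where "T = (\<chi> i j. vec.representation C (A *v \<sigma> j) (\<sigma> i))"
  have AS: "A ** S = S ** T"
  proof -
    have "(A ** S) $ i $ j = (S ** T) $ i $ j" for i j
    proof -
      have "(A ** S) $ i $ j = (A *v \<sigma> j) $ i"
        by (simp add: matrix_matrix_mult_def matrix_vector_mult_def S_def)
      also have "A *v \<sigma> j = (\<Sum>b\<in>C. vec.representation C (A *v \<sigma> j) b *s b)"
        using C finC by (simp add: vec.sum_representation_eq)
      also have "\<dots> = (\<Sum>k\<in>UNIV. T $ k $ j *s \<sigma> k)"
        by (subst sum.reindex_bij_betw[OF \<sigma>, symmetric]) (simp add: T_def)
      also have "\<dots> $ i = (S ** T) $ i $ j"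
        by (simp add: S_def matrix_matrix_mult_def mult.commute)
      finally show ?thesis .
    qed
    then show ?thesis
      by (simp add: vec_eq_iff)
  qed
  have "columns S = C"
    using \<sigma> by (auto simp: columns_def column_def S_def bij_betw_def)
  then obtain S' where "S ** S' = mat 1"
    using matrix_right_invertible_span_columns[of S] C(3) by auto
  then have "det S \<noteq> 0"
    by (metis det_I det_mul mult_zero_left zero_neq_one)
  \<comment> \<open>Evaluation at 0 recovers \<open>det S\<close>, so the lifted determinant is a
    nonzero polynomial. It can then be cancelled in the integral domain of polynomials.\<close>
  moreover have "poly (det (?const S)) 0 = det S"
    by (simp add: poly_det) (simp add: map_matrix_def)
  ultimately have detS: "det (?const S) \<noteq> 0"
    by auto
  have const_mult: "?const (U ** V) = ?const U ** ?const V" for U V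
  proof -
    have const_sum: "[:\<Sum>k\<in>UNIV. u k:] = (\<Sum>k\<in>UNIV. [:u k:])" for u :: "'n \<Rightarrow> complex"
      by (rule poly_eqI) (simp add: coeff_sum coeff_pCons split: nat.split)
    have "?const (U ** V) $ i $ j = (?const U ** ?const V) $ i $ j" for i j
      by (simp add: matrix_matrix_mult_def const_sum mult.commute[of "V $ _ $ _"])
    then show ?thesis
      by (simp add: vec_eq_iff)
  qed
  \<comment> \<open>\<open>T\<close> is the matrix of \<open>A\<close> in the basis \<open>C\<close>; on the columns in \<open>B\<close> it is triangular, with
    diagonal \<open>l\<close>, with respect to the rank \<open>r\<close>.\<close>
  let ?M = "scalar_minus [:0, 1:] (?const T)"
  have "scalar_minus [:0, 1:] (?const A) ** ?const S = ?const S ** ?M"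
  proof -
    have "mat x ** U = U ** mat x" for x :: "complex poly" and U :: "complex poly ^ 'n ^ 'n"
      by (simp add: vec_eq_iff matrix_matrix_mult_def mat_def mult.commute
          if_distrib[of "\<lambda>x. x * _"] if_distrib[of "\<lambda>x. _ * x"] cong: if_cong)
    moreover have "(U - V) ** W = U ** W - V ** W" "W ** (U - V) = W ** U - W ** V"
      for U V W :: "complex poly ^ 'n ^ 'n"
      by (simp_all add: vec_eq_iff matrix_matrix_mult_def algebra_simps sum_subtractf)
    ultimately show ?thesis
      by (simp add: scalar_minus_def AS flip: const_mult)
  qed
  then have "charpoly A * det (?const S) = det (?const S) * det ?M"
    unfolding charpoly_def det_mul[symmetric] by simp
  then have charpoly: "charpoly A = det ?M"
    using detS by simp
  define D where "D = {i. \<sigma> i \<in> B}"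
  have T: "T $ j $ i = (if j = i then l else 0) - vec.representation C (?N *v \<sigma> i) (\<sigma> j)" for i j
  proof -
    have "A *v \<sigma> i = l *s \<sigma> i - ?N *v \<sigma> i"
      by (simp add: scalar_minus_mult_vector)
    then have "T $ j $ i = l * vec.representation C (\<sigma> i) (\<sigma> j) - vec.representation C (?N *v \<sigma> i) (\<sigma> j)"
      using C by (simp add: T_def vec.representation_diff vec.representation_scale)
    moreover have "\<sigma> j = \<sigma> i \<longleftrightarrow> j = i"
      using \<sigma> by (auto simp: bij_betw_def inj_eq)
    ultimately show ?thesis
      using vec.representation_basis[OF C(2) \<sigma>C] by simp
  qed
  \<comment> \<open>The image under \<open>?N\<close> of a basis vector in \<open>B\<close> lies in
    the span of lower-ranked vectors of \<open>B\<close>, so its coordinates with respect to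
    \<open>C\<close> are supported there.\<close>
  have N: "\<sigma> j \<in> B \<and> r (\<sigma> j) < r (\<sigma> i)"
    if "i \<in> D" "vec.representation C (?N *v \<sigma> i) (\<sigma> j) \<noteq> 0" for i j
  proof -
    let ?E = "{b \<in> B. r b < r (\<sigma> i)}"
    have "vec.representation C (?N *v \<sigma> i) = vec.representation ?E (?N *v \<sigma> i)"
    proof (rule vec.representation_extend)
      show "?N *v \<sigma> i \<in> vec.span ?E"
        using that(1) by (intro B(3)) (simp add: D_def)
      show "?E \<subseteq> C"
        using C(1) by blast
    qed (rule C(2))
    then show ?thesis
      using that(2) vec.representation_ne_zero[of ?E "?N *v \<sigma> i" "\<sigma> j"] by simp
  qed
  have "[:- l, 1:] ^ card D dvd det ?M"
  proof (rule power_dvd_det_if_triangular_on[where r = "r \<circ> \<sigma>"])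
    show "?M $ i $ i = [:- l, 1:]" if "i \<in> D" for i
    proof -
      have "T $ i $ i = l"
        using N[OF that, of i] T[of i i] by auto
      then show ?thesis
        by (simp add: scalar_minus_def mat_def)
    qed
    show "j \<in> D \<and> (r \<circ> \<sigma>) j < (r \<circ> \<sigma>) i" if "i \<in> D" "j \<noteq> i" "?M $ j $ i \<noteq> 0" for i j
      using that N[of i j] T[of j i] by (auto simp: scalar_minus_def mat_def D_def)
  qed
  then have "card D \<le> alg_mult A l"
    using charpoly_nonzero[of A] by (simp add: alg_mult_def order_divides flip: charpoly)
  moreover have "card D = card B"
    using bij_betw_same_card[OF bij_betw_subset[OF \<sigma>, of D B]] C(1) \<sigma>
    by (auto simp: D_def bij_betw_def)
  moreover have "vec.dim {v. (((*v) ?N) ^^ k) v = 0} = card B"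
    using B by (metis vec.dim_span_eq_card_independent)
  ultimately show ?thesis
    by simp
qed


section \<open>Independence of indexed families\<close>

text \<open>\<open>vec.independent\<close> speaks of sets and does not see repetitions; independence
  of a family therefore amounts to injectivity together with independence of the image.\<close>

lemma inj_independent_if_coefficients_zero:
  fixes F :: "'b \<Rightarrow> 'a::field ^ 'n"
  assumes "finite I"
    and zero: "\<And>c p. (\<Sum>p\<in>I. c p *s F p) = 0 \<Longrightarrow> p \<in> I \<Longrightarrow> c p = 0"
  shows "inj_on F I" and "vec.independent (F ` I)"
proof -
  show inj: "inj_on F I"
  proof (rule inj_onI, rule ccontr)
    fix p q assume pq: "p \<in> I" "q \<in> I" "F p = F q" "p \<noteq> q"
    \<comment> \<open>The nontrivial relation that two coinciding members of the family would
      satisfy.\<close>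
    define c :: "'b \<Rightarrow> 'a" where "c x = (if x = p then 1 else 0) - (if x = q then 1 else 0)" for x
    have "(\<Sum>x\<in>I. c x *s F x) = (\<Sum>x\<in>I. if x = p then F x else 0) - (\<Sum>x\<in>I. if x = q then F x else 0)"
      by (subst sum_subtractf[symmetric]) (auto simp: c_def intro!: sum.cong)
    also have "\<dots> = 0"
      using \<open>finite I\<close> pq by simp
    finally show False
      using zero[of c p] pq by (simp add: c_def)
  qed
  show "vec.independent (F ` I)"
  proof (rule vec.independent_if_scalars_zero)
    fix u x assume "(\<Sum>x\<in>F ` I. u x *s x) = 0" "x \<in> F ` I"
    then show "u x = 0"
      using zero[of "u \<circ> F"] by (auto simp: sum.reindex[OF inj])
  qed (use \<open>finite I\<close> in simp)
qed

text \<open>The converse: a relation between the members of the family is carried to the image set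
  along the inverse of \<open>F\<close>.\<close>

lemma coefficients_zero_if_inj_independent:
  fixes F :: "'b \<Rightarrow> 'a::field ^ 'n"
  assumes "finite I" "inj_on F I" "vec.independent (F ` I)" "(\<Sum>p\<in>I. c p *s F p) = 0" "p \<in> I"
  shows "c p = 0"
proof -
  have "(\<Sum>x\<in>F ` I. c (the_inv_into I F x) *s x) = 0"
    using assms by (simp add: sum.reindex the_inv_into_f_f cong: sum.cong)
  then have "c (the_inv_into I F (F p)) = 0"
    by (rule vec.independentD[OF assms(3), rotated 2]) (use assms in auto)
  then show ?thesis
    using assms by (simp add: the_inv_into_f_f)
qed

section \<open>Jordan chains and kernels of powers\<close>

text \<open>Each application lowers the level by one, and level 1 lies in the kernel.\<close>

lemma jordan_chain_funpow:
  assumes "jordan_chains A l \<kappa> f" "j \<in> {1..geo_mult A l}" "k \<in> {1..\<kappa> j}"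
  shows "(((*v) (scalar_minus l A)) ^^ m) (f j k) = (if m < k then f j (k - m) else 0)"
proof (induction m)
  case 0
  then show ?case
    using assms by simp
next
  case (Suc m)
  have step: "scalar_minus l A *v f j i = f j (i - 1)" if "i \<in> {2..\<kappa> j}" for i
    using assms that by (auto simp: jordan_chains_def)
  have next_step: "scalar_minus l A *v f j (k - m) = f j (k - Suc m)" if "Suc m < k"
  proof -
    have "k - m \<in> {2..\<kappa> j}"
      using that assms(3) unfolding atLeastAtMost_iff by linarith
    then show ?thesis
      using step[of "k - m"] by simp
  qed
  have "f j 1 \<in> vec.span ((\<lambda>j. f j 1) ` {1..geo_mult A l})"
    using assms(2) by (auto intro: vec.span_base)
  then have "scalar_minus l A *v f j 1 = 0"
    using assms(1) by (auto simp: jordan_chains_def)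
  moreover have "k - m = 1" if "m < k" "\<not> Suc m < k"
    using that by simp
  ultimately show ?case
    using Suc next_step assms(3) by (cases "Suc m < k") auto
qed

text \<open>One statement serves two purposes: for \<open>n = 0\<close> it is the independence of
  all chain functions, and for general \<open>n\<close> it confines the kernel of the n-th power to
  levels up to \<open>n\<close>.\<close>

lemma jordan_chain_coefficients_zero:
  assumes jc: "jordan_chains A l \<kappa> f"
    and sum0: "(((*v) (scalar_minus l A)) ^^ n)
      (\<Sum>j\<in>{1..geo_mult A l}. \<Sum>k\<in>{1..\<kappa> j}. c j k *s f j k) = 0"
    and jk: "j \<in> {1..geo_mult A l}" "k \<in> {1..\<kappa> j}" "n < k"
  shows "c j k = 0"
proof (rule ccontr)
  assume c: "c j k \<noteq> 0"
  let ?G = "{1..geo_mult A l}" and ?N = "(*v) (scalar_minus l A)"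
  let ?T = "{k. \<exists>j\<in>?G. k \<in> {1..\<kappa> j} \<and> n < k \<and> c j k \<noteq> 0}"
  \<comment> \<open>The highest level above \<open>n\<close> that carries a nonzero
    coefficient.\<close>
  define K where "K = Max ?T"
  have fin: "finite ?T"
    by (rule finite_subset[of _ "\<Union>j\<in>?G. {1..\<kappa> j}"]) auto
  have "k \<in> ?T"
    using jk c by blast
  then have "K \<in> ?T"
    unfolding K_def using fin by (intro Max_in) auto
  then obtain j0 where j0: "j0 \<in> ?G" "K \<in> {1..\<kappa> j0}" "n < K" "c j0 K \<noteq> 0"
    by blast
  have above: "c i k = 0" if "i \<in> ?G" "k \<in> {1..\<kappa> i}" "K < k" for i k
  proof (rule ccontr)
    assume "c i k \<noteq> 0"
    then have "k \<in> ?T"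
      using that j0(3) by auto
    then have "k \<le> K"
      unfolding K_def using fin by (rule Max_ge[rotated])
    then show False
      using that(3) by simp
  qed
  interpret NK: Vector_Spaces.linear "(*s)" "(*s)" "?N ^^ (K - 1)"
    by (rule linear_funpow_mult)
  \<comment> \<open>As \<open>n < K\<close>, the exponent \<open>K - 1\<close> is at least
    \<open>n\<close>, so the combination is still annihilated.\<close>
  have "?N ^^ (K - 1) = (?N ^^ (K - 1 - n)) \<circ> (?N ^^ n)"
    using j0(3) by (simp flip: funpow_add)
  then have "0 = (?N ^^ (K - 1)) (\<Sum>j\<in>?G. \<Sum>k\<in>{1..\<kappa> j}. c j k *s f j k)"
    using sum0 by simp
  also have "\<dots> = (\<Sum>j\<in>?G. \<Sum>k\<in>{1..\<kappa> j}. c j k *s (?N ^^ (K - 1)) (f j k))"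
    unfolding NK.sum NK.scale ..
  \<comment> \<open>Levels below \<open>K\<close> are annihilated, levels above \<open>K\<close>
    have coefficient 0, and level \<open>K\<close> descends exactly to the eigenfunction
    \<open>f j 1\<close>.\<close>
  also have "\<dots> = (\<Sum>j\<in>?G. \<Sum>k\<in>{1..\<kappa> j}. if k = K then c j K *s f j 1 else 0)"
  proof (intro sum.cong refl)
    fix j k assume jk: "j \<in> ?G" "k \<in> {1..\<kappa> j}"
    show "c j k *s (?N ^^ (K - 1)) (f j k) = (if k = K then c j K *s f j 1 else 0)"
      using above[OF jk] j0(3) by (auto simp: jordan_chain_funpow[OF jc jk] not_less_iff_gr_or_eq)
  qed
  \<comment> \<open>Chains shorter than \<open>K\<close> have no term of level \<open>K\<close> and
    receive the coefficient 0.\<close>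
  also have "\<dots> = (\<Sum>j\<in>?G. (if K \<le> \<kappa> j then c j K else 0) *s f j 1)"
    using j0 by (intro sum.cong refl) auto
  finally have "(if K \<le> \<kappa> j0 then c j0 K else 0) = 0"
    using jc j0(1)
    by (intro coefficients_zero_if_inj_independent[of ?G "\<lambda>j. f j 1"]) (auto simp: jordan_chains_def)
  then show False
    using j0 by auto
qed

text \<open>Counting dimensions works for a power so high that its kernel contains every chain
  function. The kernel of the n-th power lies inside that kernel and is then cut out by the
  vanishing of coefficients above level \<open>n\<close>.\<close>

lemma kernel_power_eq_span_jordan_chains:
  assumes jc: "jordan_chains A l \<kappa> f"
  shows "{v. (((*v) (scalar_minus l A)) ^^ n) v = 0} =
    vec.span {f j k | j k. j \<in> {1..geo_mult A l} \<and> k \<in> {1..min n (\<kappa> j)}}"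
    (is "?ker n = vec.span ?F")
proof
  let ?G = "{1..geo_mult A l}"
  have subspace: "vec.subspace (?ker m)" for m
    by (rule vec.linear_subspace_kernel) (rule linear_funpow_mult)
  have "?F \<subseteq> ?ker n"
    by (auto simp: jordan_chain_funpow[OF jc])
  then show "vec.span ?F \<subseteq> ?ker n"
    using subspace by (rule vec.span_minimal)
  define I where "I = Sigma ?G (\<lambda>j. {1..\<kappa> j})"
  have finI: "finite I"
    by (simp add: I_def)
  let ?f = "case_prod f"
  have nested: "(\<Sum>p\<in>I. c p *s ?f p) = (\<Sum>j\<in>?G. \<Sum>k\<in>{1..\<kappa> j}. c (j, k) *s f j k)" for c
    unfolding I_def by (subst sum.Sigma) (auto intro!: sum.cong)
  have zero: "c p = 0" if "(\<Sum>p\<in>I. c p *s ?f p) = 0" "p \<in> I" for c p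
  proof -
    obtain j k where p: "p = (j, k)" "j \<in> ?G" "k \<in> {1..\<kappa> j}"
      using \<open>p \<in> I\<close> by (auto simp: I_def)
    \<comment> \<open>With exponent 0 the condition \<open>n < k\<close> holds at every level, since
      levels start at 1.\<close>
    have "(((*v) (scalar_minus l A)) ^^ 0) (\<Sum>j\<in>?G. \<Sum>k\<in>{1..\<kappa> j}. c (j, k) *s f j k) = 0"
      using that(1) by (simp add: nested)
    from jordan_chain_coefficients_zero[OF jc this p(2,3)] p show ?thesis
      by simp
  qed
  have inj: "inj_on ?f I" and indep: "vec.independent (?f ` I)"
    using inj_independent_if_coefficients_zero[of I ?f] finI zero by blast+
  \<comment> \<open>Large enough for both inclusions: every chain length is at most the sum
    \<open>alg_mult A l\<close> of all of them, and \<open>n \<le> m\<close>.\<close>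
  define m where "m = alg_mult A l + n"
  have \<kappa>: "(\<Sum>j\<in>?G. \<kappa> j) = alg_mult A l"
    using jc by (auto simp: jordan_chains_def)
  have "\<kappa> j \<le> m" if "j \<in> ?G" for j
    using member_le_sum[of j ?G \<kappa>] that \<kappa> by (simp add: m_def)
  then have sub: "?f ` I \<subseteq> ?ker m"
    using jordan_chain_funpow[OF jc] by (fastforce simp: I_def)
  have "card (?f ` I) = alg_mult A l"
    using \<kappa> by (simp add: card_image[OF inj]) (simp add: I_def)
  \<comment> \<open>An independent subset with at least as many elements as the dimension
    spans.\<close>
  then have "?ker m \<subseteq> vec.span (?f ` I)"
    using dim_kernel_power_le_alg_mult[where l = l and A = A and k = m] by (intro vec.card_ge_dim_independent sub indep) simp
  moreover have "?ker n \<subseteq> ?ker m"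
    by (auto simp: m_def funpow_add)
  ultimately have "?ker n \<subseteq> vec.span (?f ` I)"
    by blast
  show "?ker n \<subseteq> vec.span ?F"
  proof
    fix v assume v: "v \<in> ?ker n"
    then have "v \<in> range (\<lambda>u. \<Sum>x\<in>?f ` I. u x *s x)"
      using \<open>?ker n \<subseteq> vec.span (?f ` I)\<close> finI by (subst vec.span_finite[symmetric]) auto
    then obtain u where "v = (\<Sum>x\<in>?f ` I. u x *s x)"
      by auto
    then have veq: "v = (\<Sum>p\<in>I. (u \<circ> ?f) p *s ?f p)"
      by (simp add: sum.reindex[OF inj])
    have "(u \<circ> ?f) p *s ?f p \<in> vec.span ?F" if p: "p \<in> I" for p
    proof -
      obtain j k where p: "p = (j, k)" "j \<in> ?G" "k \<in> {1..\<kappa> j}"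
        using p by (auto simp: I_def)
      show ?thesis
      proof (cases "k \<le> n")
        case True
        then have "f j k \<in> ?F"
          using p by auto
        then show ?thesis
          by (simp add: p vec.span_base vec.span_scale)
      next
        case False
        have "(((*v) (scalar_minus l A)) ^^ n) (\<Sum>j\<in>?G. \<Sum>k\<in>{1..\<kappa> j}. (u \<circ> ?f) (j, k) *s f j k) = 0"
          using v unfolding veq nested by simp
        from jordan_chain_coefficients_zero[OF jc this p(2,3)] False show ?thesis
          by (simp add: p vec.span_zero)
      qed
    qed
    then show "v \<in> vec.span ?F"
      unfolding veq by (rule vec.span_sum)
  qed
qed

section \<open>Zero extension and stochastic matrices\<close>

lemma sum_UNIV_sum_type:
  "(\<Sum>z\<in>UNIV. h z) = (\<Sum>x\<in>UNIV. h (Inl x)) + (\<Sum>w\<in>UNIV. h (Inr w))"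
  for h :: "'i::finite + 'b::finite \<Rightarrow> 'a::comm_monoid_add"
  by (simp add: sum.Plus comp_def flip: UNIV_Plus_UNIV)

lemma linear_extend_zero:
  "Vector_Spaces.linear (*s) (*s) (extend_zero :: 'a::field ^ 'i::finite \<Rightarrow> 'a ^ ('i + 'b::finite))"
  by unfold_locales (auto simp: vec_eq_iff extend_zero_def algebra_simps split: sum.split)

lemma stochastic_mult:
  assumes "stochastic A" "stochastic B"
  shows "stochastic (A ** B)"
proof -
  have "(\<Sum>y\<in>UNIV. \<Sum>k\<in>UNIV. A $ x $ k * B $ k $ y) = 1" for x
    using assms by (subst sum.swap) (simp add: stochastic_def flip: sum_distrib_left)
  then show ?thesis
    using assms by (simp add: stochastic_def matrix_matrix_mult_def sum_nonneg)
qed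

lemma stochastic_mpow: "stochastic P \<Longrightarrow> stochastic (mpow P m)"
proof (induction m)
  case 0
  then show ?case
    by (simp add: stochastic_def mat_def)
qed (simp add: stochastic_mult)

lemma complex_mat_mult: "complex_mat (A ** B) = complex_mat A ** complex_mat B"
  by (simp add: vec_eq_iff complex_mat_def matrix_matrix_mult_def)

lemma complex_mat_mpow_fixed:
  assumes "complex_mat P *v g = g"
  shows "complex_mat (mpow P m) *v g = g"
proof (induction m)
  case 0
  have "complex_mat (mat 1 :: real ^ 'a ^ 'a) = mat 1"
    by (simp add: vec_eq_iff complex_mat_def mat_def)
  then show ?case
    by simp
next
  case (Suc m)
  then show ?case
    using assms by (simp add: complex_mat_mult flip: matrix_vector_mul_assoc)
qed

text \<open>The other entries of the row are nonnegative and sum to 0.\<close>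

lemma boundary_row:
  assumes "stochastic P" "P $ w $ w = 1"
  shows "P $ w $ z = (if z = w then 1 else 0)"
proof -
  have "(\<Sum>y\<in>UNIV. P $ w $ y) = P $ w $ w + (\<Sum>y\<in>UNIV - {w}. P $ w $ y)"
    by (rule sum.remove) auto
  then have "(\<Sum>y\<in>UNIV - {w}. P $ w $ y) = 0"
    using assms by (simp add: stochastic_def)
  then have "\<forall>y\<in>UNIV - {w}. P $ w $ y = 0"
    using assms by (subst (asm) sum_nonneg_eq_0_iff) (auto simp: stochastic_def)
  then show ?thesis
    using assms by simp
qed

section \<open>Absorbing boundary\<close>

context
  fixes P :: "real ^ ('i::finite + 'b::finite) ^ ('i + 'b)"
  assumes P: "stochastic P" and absorbing: "\<And>w::'b. P $ Inr w $ Inr w = 1"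
begin

lemma complex_mat_boundary: "(complex_mat P *v g) $ Inr w = g $ Inr w"
  by (simp add: complex_mat_def matrix_vector_mult_def boundary_row[OF P absorbing]
      if_distrib[of of_real] if_distrib[of "\<lambda>x. x * _"] cong: if_cong)

text \<open>In interior rows the boundary summands vanish; in boundary rows \<open>P\<close>
  preserves the value 0. So zero extension intertwines the interior block with
  \<open>P\<close>.\<close>

lemma complex_mat_extend_zero:
  "complex_mat P *v extend_zero v = extend_zero (interior_block (complex_mat P) *v v)"
proof -
  have "(complex_mat P *v extend_zero v) $ z = extend_zero (interior_block (complex_mat P) *v v) $ z" for z
  proof (cases z)
    case (Inl x)
    then show ?thesis
      by (simp add: matrix_vector_mult_def sum_UNIV_sum_type extend_zero_def interior_block_def)
  next
    case (Inr w)
    then show ?thesis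
      by (simp add: complex_mat_boundary) (simp add: extend_zero_def)
  qed
  then show ?thesis
    by (simp add: vec_eq_iff)
qed

lemma funpow_scalar_minus_extend_zero:
  "(((*v) (scalar_minus l (complex_mat P))) ^^ n) (extend_zero v) =
    extend_zero ((((*v) (scalar_minus l (interior_block (complex_mat P)))) ^^ n) v)"
proof (induction n)
  case (Suc n)
  interpret ext: Vector_Spaces.linear "(*s)" "(*s)" "extend_zero :: complex ^ 'i \<Rightarrow> complex ^ ('i + 'b)"
    by (rule linear_extend_zero)
  have "scalar_minus l (complex_mat P) *v extend_zero u =
      extend_zero (scalar_minus l (interior_block (complex_mat P)) *v u)" for u
    by (simp add: scalar_minus_mult_vector complex_mat_extend_zero ext.diff ext.scale)
  then show ?case
    by (simp add: Suc)
qed simp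

lemma funpow_scalar_minus_boundary:
  "((((*v) (scalar_minus l (complex_mat P))) ^^ n) g) $ Inr w = (l - 1) ^ n * g $ Inr w"
  by (induction n) (simp_all add: scalar_minus_mult_vector complex_mat_boundary algebra_simps)

text \<open>Maximum principle: where the modulus of an eigenfunction is largest, its value is an
  average that gives positive weight to a boundary point with value 0, so the modulus would be
  smaller than itself.\<close>

lemma one_notin_spec_interior_block:
  assumes reach: "\<And>x::'i. \<exists>w::'b. \<exists>m. mpow P m $ Inl x $ Inr w > 0"
  shows "1 \<notin> spec (interior_block (complex_mat P))"
proof
  assume "1 \<in> spec (interior_block (complex_mat P))"
  then obtain v where v: "v \<noteq> 0" "interior_block (complex_mat P) *v v = v"
    by (auto simp: spec_def)
  define g :: "complex ^ ('i + 'b)" where "g = extend_zero v"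
  have g: "complex_mat P *v g = g"
    using v by (simp add: g_def complex_mat_extend_zero)
  have "Max (range (\<lambda>x. norm (v $ x))) \<in> range (\<lambda>x. norm (v $ x))"
    by (intro Max_in) auto
  then obtain x where x: "Max (range (\<lambda>x. norm (v $ x))) = norm (v $ x)"
    by (elim rangeE)
  have max: "norm (v $ y) \<le> norm (v $ x)" for y
    unfolding x[symmetric] by (rule Max_ge) auto
  have pos: "norm (v $ x) > 0"
  proof (rule ccontr)
    assume "\<not> norm (v $ x) > 0"
    then have "v $ y = 0" for y
      using max[of y] by simp
    then show False
      using v(1) by (simp add: vec_eq_iff)
  qed
  obtain w m where wm: "mpow P m $ Inl x $ Inr w > 0"
    using reach by blast
  define M where "M = mpow P m"
  have M: "stochastic M" "M $ Inl x $ Inr w > 0"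
    using wm P by (simp_all add: M_def stochastic_mpow)
  \<comment> \<open>The uniform bound is sharpened only at \<open>Inr w\<close>, where
    \<open>g\<close> vanishes; this one point makes the final estimate strict.\<close>
  have gmax: "norm (g $ z) \<le> norm (v $ x) * (if z = Inr w then 0 else 1)" for z
    using max by (cases z) (auto simp: g_def extend_zero_def)
  have "v $ x = (complex_mat M *v g) $ Inl x"
    unfolding M_def complex_mat_mpow_fixed[OF g] by (simp add: g_def extend_zero_def)
  also have "\<dots> = (\<Sum>z\<in>UNIV. M $ Inl x $ z *\<^sub>R g $ z)"
    by (simp add: matrix_vector_mult_def complex_mat_def scaleR_conv_of_real)
  also have "norm \<dots> \<le> (\<Sum>z\<in>UNIV. M $ Inl x $ z * (norm (v $ x) * (if z = Inr w then 0 else 1)))"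
  proof (rule sum_norm_le)
    fix z
    have "0 \<le> M $ Inl x $ z"
      using M(1) by (simp add: stochastic_def)
    then show "norm (M $ Inl x $ z *\<^sub>R g $ z) \<le>
        M $ Inl x $ z * (norm (v $ x) * (if z = Inr w then 0 else 1))"
      using mult_left_mono[OF gmax[of z]] by simp
  qed
  also have "\<dots> = norm (v $ x) * (\<Sum>z\<in>UNIV. M $ Inl x $ z - (if z = Inr w then M $ Inl x $ z else 0))"
    by (subst sum_distrib_left) (auto intro!: sum.cong)
  also have "\<dots> = norm (v $ x) * (1 - M $ Inl x $ Inr w)"
    using M(1) by (simp add: sum_subtractf stochastic_def)
  also have "\<dots> < norm (v $ x)"
    using M(2) pos by (simp add: algebra_simps)
  finally show False
    by simp
qed

text \<open>At a boundary point the power multiplies by \<open>(l - 1) ^ n\<close>, which is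
  nonzero. A kernel function thus vanishes on the boundary and is the zero extension of its
  restriction to the interior.\<close>

lemma kernel_power_eq_extend_zero_image:
  assumes "l \<noteq> 1"
  shows "{g. (((*v) (scalar_minus l (complex_mat P))) ^^ n) g = 0} =
    extend_zero ` {v. (((*v) (scalar_minus l (interior_block (complex_mat P)))) ^^ n) v = 0}"
    (is "?L = extend_zero ` ?R")
proof -
  have extend_zero_eq_0: "extend_zero v = (0 :: complex ^ ('i + 'b)) \<longleftrightarrow> v = 0" for v :: "complex ^ 'i"
    by (auto simp: vec_eq_iff extend_zero_def split: sum.split)
  show ?thesis
  proof (intro equalityI subsetI)
    fix g assume g: "g \<in> ?L"
    have "g $ Inr w = 0" for w
      using funpow_scalar_minus_boundary[of n l g w] g assms by simp
    then have "g = extend_zero (\<chi> x. g $ Inl x)"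
      by (auto simp: vec_eq_iff extend_zero_def split: sum.split)
    with g show "g \<in> extend_zero ` ?R"
      using funpow_scalar_minus_extend_zero[of n l "\<chi> x. g $ Inl x"] by (auto simp: extend_zero_eq_0)
  qed (auto simp: funpow_scalar_minus_extend_zero extend_zero_eq_0)
qed

end

section \<open>Kernels of powers on the whole state space\<close>

theorem mainTheorem4:
  fixes P :: "real ^ ('i::finite + 'b::finite) ^ ('i + 'b)"
    and l :: complex
    and n :: nat
    and \<kappa> :: "nat \<Rightarrow> nat"
    and f :: "nat \<Rightarrow> nat \<Rightarrow> complex ^ 'i"
  assumes "stochastic P"
    and "\<forall>x::'i. \<exists>w::'b. \<exists>m. mpow P m $ Inl x $ Inr w > 0"
    and "\<forall>w::'b. P $ Inr w $ Inr w = 1"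
    and "\<forall>w::'b. \<exists>x::'i. \<exists>m. mpow P m $ Inl x $ Inr w > 0"
    and "l \<in> spec (interior_block (complex_mat P))"
    and "n \<ge> 1"
    and "jordan_chains (interior_block (complex_mat P)) l \<kappa> f"
  shows "{g :: complex ^ ('i + 'b). mpow (scalar_minus l (complex_mat P)) n *v g = 0} =
    vec.span {extend_zero (f j k) | j k.
      j \<in> {1..geo_mult (interior_block (complex_mat P)) l} \<and> k \<in> {1..min n (\<kappa> j)}}"
proof -
  let ?Q = "interior_block (complex_mat P)"
  interpret ext: Vector_Spaces.linear "(*s)" "(*s)" "extend_zero :: complex ^ 'i \<Rightarrow> complex ^ ('i + 'b)"
    by (rule linear_extend_zero)
  have "l \<noteq> 1"
    using one_notin_spec_interior_block[of P] assms by blast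
  then have "{g. mpow (scalar_minus l (complex_mat P)) n *v g = 0} =
      extend_zero ` {v. (((*v) (scalar_minus l ?Q)) ^^ n) v = 0}"
    using kernel_power_eq_extend_zero_image[of P l n] assms by (simp add: mpow_mult_vector)
  also have "\<dots> = vec.span (extend_zero ` {f j k | j k. j \<in> {1..geo_mult ?Q l} \<and> k \<in> {1..min n (\<kappa> j)}})"
    unfolding kernel_power_eq_span_jordan_chains[OF assms(7)] by (rule ext.span_image[symmetric])
  also have "extend_zero ` {f j k | j k. j \<in> {1..geo_mult ?Q l} \<and> k \<in> {1..min n (\<kappa> j)}} =
      {extend_zero (f j k) | j k. j \<in> {1..geo_mult ?Q l} \<and> k \<in> {1..min n (\<kappa> j)}}"
    by blast
  finally show ?thesis .
qed

end
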